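(* Let $M$ be a matroid with an adjoint map $\phi$ to $M'$. If $D$ is a coindependent set in $M$, then there is an adjoint map $\phi_{\backslash D}$ from $M\backslash D$ to $N=M'\backslash\phi(\mathcal{H}(M,D))$ given by $\phi_{\backslash D}(F)=\phi(\mathrm{cl}_M(F))-\phi(\mathcal{H}(M,D))$ for flats $F$ of $M\backslash D$.
   Context: Matroid terminology follows Oxley's book; in particular matroids are finite. $E(M)$ is the ground set of $M$, $r_M$ its rank function, $\mathrm{cl}_M$ its closure operator, $\mathcal{F}(M)$ the collection of flats of $M$, and $M\backslash D$ is deletion. A set $D\subseteq E(M)$ is coindependent in $M$ if it is independent in the dual matroid $M^*$ (equivalently, $r_M(E(M)-D)=r(M)$). A hyperplane of $M$ is a flat of rank $r(M)-1$; a point is a flat of rank $1$ (in a simple matroid, the points are exactly the singletons of elements of the ground set, and are identified with the elements). Definition. Let $M$ be a matroid, and let $M'$ be a simple matroid with the same rank as $M$. Then $M'$ is an adjoint of $M$ if there is a map $\phi:\mathcal{F}(M)\rightarrow\mathcal{F}(M')$ such that (i) $\phi$ is injective; (ii) if $F_1,F_2\in\mathcal{F}(M)$ and $F_1\subseteq F_2$, then $\phi(F_2)\subseteq\phi(F_1)$; and (iii) $\phi$ restricts to a bijection from the set of hyperplanes of $M$ onto the set of points of $M'$. Such a map $\phi$ is called an adjoint map from $M$ to $M'$. (Thus saying that there is an adjoint map from one matroid to another includes that the second matroid is simple and has the same rank as the first.) Definition. For a matroid $M$ and $D\subseteq E(M)$, let $\mathcal{H}(M)$ be the set of hyperplanes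 of $M$ and let $\mathcal{H}(M,D)=\{H\in\mathcal{H}(M): r_M(H-D)<r_M(H)\}$. Since $\phi$ maps each hyperplane of $M$ to a point of $M'$, i.e. to (the singleton of) an element of $E(M')$, the notation $\phi(\mathcal{H}(M,D))$ means the set of elements of $E(M')$ that are images under $\phi$ of the members of $\mathcal{H}(M,D)$; it is a subset of $E(M')$. *)

theory Defs
  imports Main
begin

section \<open>Finite matroids\<close>

definition matroid_axioms :: "'a set \<Rightarrow> 'a set set \<Rightarrow> bool" where
  "matroid_axioms E \<I> \<longleftrightarrow>
     finite E \<and> (\<forall>X\<in>\<I>. X \<subseteq> E) \<and> {} \<in> \<I> \<and>
     (\<forall>Y\<in>\<I>. \<forall>X. X \<subseteq> Y \<longrightarrow> X \<in> \<I>) \<and>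
     (\<forall>X\<in>\<I>. \<forall>Y\<in>\<I>. card X < card Y \<longrightarrow> (\<exists>y\<in>Y - X. insert y X \<in> \<I>))"

typedef 'a matroid = "{(E :: 'a set, \<I>). matroid_axioms E \<I>}"
proof
  show "({}, {{}}) \<in> {(E :: 'a set, \<I>). matroid_axioms E \<I>}"
    by (simp add: matroid_axioms_def)
qed

definition ground :: "'a matroid \<Rightarrow> 'a set" where
  "ground M = fst (Rep_matroid M)"

definition indeps :: "'a matroid \<Rightarrow> 'a set set" where
  "indeps M = snd (Rep_matroid M)"

lemma matroid_axioms_ground_indeps: "matroid_axioms (ground M) (indeps M)"
  using Rep_matroid[of M] by (auto simp: ground_def indeps_def)

lemma ground_Abs: "matroid_axioms E \<I> \<Longrightarrow> ground (Abs_matroid (E, \<I>)) = E"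
  by (simp add: ground_def Abs_matroid_inverse)

lemma indeps_Abs: "matroid_axioms E \<I> \<Longrightarrow> indeps (Abs_matroid (E, \<I>)) = \<I>"
  by (simp add: indeps_def Abs_matroid_inverse)

lemma finite_ground: "finite (ground M)"
  and indeps_subset_ground: "X \<in> indeps M \<Longrightarrow> X \<subseteq> ground M"
  and empty_indeps: "{} \<in> indeps M"
  and indeps_subset: "Y \<in> indeps M \<Longrightarrow> X \<subseteq> Y \<Longrightarrow> X \<in> indeps M"
  and indeps_augment:
    "X \<in> indeps M \<Longrightarrow> Y \<in> indeps M \<Longrightarrow> card X < card Y \<Longrightarrow> \<exists>y\<in>Y - X. insert y X \<in> indeps M"
  using matroid_axioms_ground_indeps[of M] unfolding matroid_axioms_def by blast+

lemma indeps_finite: "X \<in> indeps M \<Longrightarrow> finite X"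
  using finite_ground indeps_subset_ground finite_subset by metis

definition bases :: "'a matroid \<Rightarrow> 'a set set" where
  "bases M = {B \<in> indeps M. \<forall>X\<in>indeps M. B \<subseteq> X \<longrightarrow> X = B}"

definition circuits :: "'a matroid \<Rightarrow> 'a set set" where
  "circuits M = {C. C \<subseteq> ground M \<and> C \<notin> indeps M \<and> (\<forall>X. X \<subset> C \<longrightarrow> X \<in> indeps M)}"

text \<open>No loops (one-element circuits) and no two distinct parallel elements
  (two-element circuits).\<close>
definition simple_matroid :: "'a matroid \<Rightarrow> bool" where
  "simple_matroid M \<longleftrightarrow> (\<forall>e. {e} \<notin> circuits M) \<and> (\<forall>e f. {e, f} \<notin> circuits M)"

definition rk :: "'a matroid \<Rightarrow> 'a set \<Rightarrow> nat" where
  "rk M X = Max (card ` {I \<in> indeps M. I \<subseteq> X})"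

definition cl :: "'a matroid \<Rightarrow> 'a set \<Rightarrow> 'a set" where
  "cl M X = {e \<in> ground M. rk M (insert e X) = rk M X}"

definition flats :: "'a matroid \<Rightarrow> 'a set set" where
  "flats M = {F. F \<subseteq> ground M \<and> cl M F = F}"

text \<open>Written additively to avoid truncated subtraction: a matroid of rank 0 has no
  hyperplanes.\<close>
definition hyperplanes :: "'a matroid \<Rightarrow> 'a set set" where
  "hyperplanes M = {H \<in> flats M. rk M H + 1 = rk M (ground M)}"

definition points :: "'a matroid \<Rightarrow> 'a set set" where
  "points M = {P \<in> flats M. rk M P = 1}"


section \<open>Deletion and duality\<close>

definition deletion :: "'a matroid \<Rightarrow> 'a set \<Rightarrow> 'a matroid" where
  "deletion M D = Abs_matroid (ground M - D, {X \<in> indeps M. X \<inter> D = {}})"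

lemma matroid_axiomsI:
  assumes "finite E" "\<And>X. X \<in> \<I> \<Longrightarrow> X \<subseteq> E" "{} \<in> \<I>"
    and "\<And>X Y. Y \<in> \<I> \<Longrightarrow> X \<subseteq> Y \<Longrightarrow> X \<in> \<I>"
    and "\<And>X Y. X \<in> \<I> \<Longrightarrow> Y \<in> \<I> \<Longrightarrow> card X < card Y \<Longrightarrow> \<exists>y\<in>Y - X. insert y X \<in> \<I>"
  shows "matroid_axioms E \<I>"
  using assms unfolding matroid_axioms_def by simp

lemma deletion_axioms:
  "matroid_axioms (ground M - D) {X \<in> indeps M. X \<inter> D = {}}"
proof (rule matroid_axiomsI)
  show "finite (ground M - D)" using finite_ground by blast
  show "X \<subseteq> ground M - D" if "X \<in> {X \<in> indeps M. X \<inter> D = {}}" for X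
    using that indeps_subset_ground[of X M] by blast
  show "{} \<in> {X \<in> indeps M. X \<inter> D = {}}" using empty_indeps[of M] by simp
  show "X \<in> {X \<in> indeps M. X \<inter> D = {}}" if "Y \<in> {X \<in> indeps M. X \<inter> D = {}}" "X \<subseteq> Y" for X Y
    using that indeps_subset[of Y M X] by blast
  show "\<exists>y\<in>Y - X. insert y X \<in> {X \<in> indeps M. X \<inter> D = {}}"
    if "X \<in> {X \<in> indeps M. X \<inter> D = {}}" "Y \<in> {X \<in> indeps M. X \<inter> D = {}}" "card X < card Y" for X Y
    using that indeps_augment[of X M Y] by blast
qed

lemma ground_deletion: "ground (deletion M D) = ground M - D"
  and indeps_deletion: "indeps (deletion M D) = {X \<in> indeps M. X \<inter> D = {}}"
  using deletion_axioms[of M D] by (simp_all add: deletion_def ground_Abs indeps_Abs)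

lemma indeps_extend:
  assumes "X \<in> indeps M" "Y \<in> indeps M" "card X \<le> card Y"
  shows "\<exists>Z\<in>indeps M. X \<subseteq> Z \<and> Z \<subseteq> X \<union> Y \<and> card Z = card Y"
  using assms
proof (induction "card Y - card X" arbitrary: X)
  case 0
  then show ?case by (intro bexI[of _ X]) auto
next
  case (Suc n)
  then obtain y where y: "y \<in> Y - X" "insert y X \<in> indeps M"
    using indeps_augment[of X M Y] by (metis zero_less_Suc zero_less_diff)
  have "card (insert y X) = Suc (card X)"
    using y indeps_finite[OF Suc.prems(1)] by simp
  then have "\<exists>Z\<in>indeps M. insert y X \<subseteq> Z \<and> Z \<subseteq> insert y X \<union> Y \<and> card Z = card Y"
    using Suc y by (intro Suc.hyps(1)) auto
  then show ?case using y by blast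
qed

lemma bases_card_max: "B \<in> bases M \<Longrightarrow> X \<in> indeps M \<Longrightarrow> card X \<le> card B"
  using indeps_augment[of B M X] unfolding bases_def by (force simp: not_less[symmetric])

lemma bases_card_eq: "B \<in> bases M \<Longrightarrow> B' \<in> bases M \<Longrightarrow> card B = card B'"
  using bases_card_max[of B M B'] bases_card_max[of B' M B] by (auto simp: bases_def)

lemma basesI:
  assumes B: "B \<in> bases M" and X: "X \<in> indeps M" and eq: "card X = card B"
  shows "X \<in> bases M"
proof -
  have "Y = X" if Y: "Y \<in> indeps M" "X \<subseteq> Y" for Y
    using card_seteq[OF indeps_finite[OF Y(1)] Y(2)] bases_card_max[OF B Y(1)] eq by simp
  then show ?thesis using X by (simp add: bases_def)
qed

lemma bases_nonempty: "\<exists>B. B \<in> bases M"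
proof -
  have "finite (indeps M)"
    using finite_ground[of M] indeps_subset_ground[of _ M] finite_subset[of "indeps M" "Pow (ground M)"]
    by auto
  then obtain B where "B \<in> indeps M" "\<forall>X\<in>indeps M. B \<subseteq> X \<longrightarrow> B = X"
    using finite_has_maximal[of "indeps M"] empty_indeps by (metis empty_iff)
  then show ?thesis by (auto simp: bases_def)
qed

text \<open>The bases of the dual are the complements of the bases of \<open>M\<close>, so its independent sets
  are the subsets of these complements (see \<open>bases_dual\<close> below).\<close>
definition dual :: "'a matroid \<Rightarrow> 'a matroid" where
  "dual M = Abs_matroid (ground M, {X. \<exists>B\<in>bases M. X \<subseteq> ground M - B})"

lemma dual_axioms: "matroid_axioms (ground M) {X. \<exists>B\<in>bases M. X \<subseteq> ground M - B}"
proof -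
  have aug: "\<exists>y\<in>Y - X. \<exists>B\<in>bases M. insert y X \<subseteq> ground M - B"
    if X: "B1 \<in> bases M" "X \<subseteq> ground M - B1" and Y: "B2 \<in> bases M" "Y \<subseteq> ground M - B2"
      and less: "card X < card Y" for X Y B1 B2
  proof (rule ccontr)
    assume none: "\<not> ?thesis"
    have fin: "finite X" "finite Y" "finite B2"
      using X Y finite_ground[of M] indeps_finite[of B2 M]
      by (auto simp: bases_def intro: finite_subset)
    have ind: "B1 \<in> indeps M" "B2 \<in> indeps M" using X Y by (auto simp: bases_def)
    have i: "B2 - X \<in> indeps M" using ind indeps_subset by blast
    obtain Z where Z: "Z \<in> indeps M" "B2 - X \<subseteq> Z" "Z \<subseteq> (B2 - X) \<union> B1" "card Z = card B1"
      using indeps_extend[OF i ind(1)] bases_card_max[OF X(1) i] by auto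
    have ZB: "Z \<in> bases M" using basesI[OF X(1) Z(1) Z(4)] .
    have "Y - X \<subseteq> Z"
    proof
      fix y assume y: "y \<in> Y - X"
      then have "\<not> insert y X \<subseteq> ground M - Z" using none ZB by blast
      then show "y \<in> Z" using y X Y Z by auto
    qed
    then have "(Y - X) \<union> (B2 - X) \<subseteq> Z" using Z by auto
    then have "card ((Y - X) \<union> (B2 - X)) \<le> card Z"
      using indeps_finite[OF Z(1)] card_mono by blast
    moreover have "card ((Y - X) \<union> (B2 - X)) = card (Y - X) + card (B2 - X)"
      using fin Y by (intro card_Un_disjoint) auto
    moreover have "card (X - Y) < card (Y - X)"
      using less fin by (simp add: card_less_sym_Diff)
    moreover have "card (B2 \<inter> X) \<le> card (X - Y)"
      using fin Y by (intro card_mono) auto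
    moreover have "card B2 = card (B2 \<inter> X) + card (B2 - X)"
      using fin by (metis card_Int_Diff)
    moreover have "card Z = card B2" using bases_card_eq[OF ZB Y(1)] .
    ultimately show False by linarith
  qed
  let ?\<I> = "{X. \<exists>B\<in>bases M. X \<subseteq> ground M - B}"
  show ?thesis
  proof (rule matroid_axiomsI)
    show "finite (ground M)" by (rule finite_ground)
    show "X \<subseteq> ground M" if "X \<in> ?\<I>" for X using that by blast
    show "{} \<in> ?\<I>" using bases_nonempty[of M] by blast
    show "X \<in> ?\<I>" if "Y \<in> ?\<I>" "X \<subseteq> Y" for X Y using that by blast
    show "\<exists>y\<in>Y - X. insert y X \<in> ?\<I>"
      if "X \<in> ?\<I>" "Y \<in> ?\<I>" "card X < card Y" for X Y
    proof -
      obtain B1 B2 where "B1 \<in> bases M" "X \<subseteq> ground M - B1" "B2 \<in> bases M" "Y \<subseteq> ground M - B2"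
        using \<open>X \<in> ?\<I>\<close> \<open>Y \<in> ?\<I>\<close> by blast
      from aug[OF this \<open>card X < card Y\<close>] show ?thesis by simp
    qed
  qed
qed

lemma ground_dual: "ground (dual M) = ground M"
  and indeps_dual: "indeps (dual M) = {X. \<exists>B\<in>bases M. X \<subseteq> ground M - B}"
  using dual_axioms[of M] by (simp_all add: dual_def ground_Abs indeps_Abs)

lemma bases_dual: "bases (dual M) = (\<lambda>B. ground M - B) ` bases M"
proof (intro equalityI subsetI)
  fix C assume C: "C \<in> bases (dual M)"
  then obtain B where B: "B \<in> bases M" "C \<subseteq> ground M - B"
    by (auto simp: bases_def[of "dual M"] indeps_dual)
  then have "ground M - B \<in> indeps (dual M)" by (auto simp: indeps_dual)
  then have "ground M - B = C" using B C by (auto simp: bases_def[of "dual M"])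
  then show "C \<in> (\<lambda>B. ground M - B) ` bases M" using B by auto
next
  fix C assume "C \<in> (\<lambda>B. ground M - B) ` bases M"
  then obtain B where B: "B \<in> bases M" "C = ground M - B" by auto
  have "X = C" if "C \<subseteq> X" "B' \<in> bases M" "X \<subseteq> ground M - B'" for X B'
  proof -
    have "B' \<subseteq> B"
      using that B indeps_subset_ground[of B' M] by (auto simp: bases_def)
    then have "B' = B" using that B by (auto simp: bases_def)
    then show ?thesis using that B by auto
  qed
  then show "C \<in> bases (dual M)" using B by (auto simp: bases_def[of "dual M"] indeps_dual)
qed

definition coindependent :: "'a matroid \<Rightarrow> 'a set \<Rightarrow> bool" where
  "coindependent M D \<longleftrightarrow> D \<in> indeps (dual M)"


lemma finite_card_indeps: "finite (card ` {I \<in> indeps M. I \<subseteq> X})"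
proof -
  have "{I \<in> indeps M. I \<subseteq> X} \<subseteq> Pow (ground M)" using indeps_subset_ground by blast
  then show ?thesis using finite_ground[of M] by (meson finite_Pow_iff finite_imageI finite_subset)
qed

lemma rk_ge: "I \<in> indeps M \<Longrightarrow> I \<subseteq> X \<Longrightarrow> card I \<le> rk M X"
  unfolding rk_def by (intro Max_ge finite_card_indeps) auto

lemma rk_attained: "\<exists>I\<in>indeps M. I \<subseteq> X \<and> card I = rk M X"
proof -
  have "{} \<in> {I \<in> indeps M. I \<subseteq> X}" using empty_indeps[of M] by simp
  then have "card ` {I \<in> indeps M. I \<subseteq> X} \<noteq> {}" by blast
  from Max_in[OF finite_card_indeps this]
  have "rk M X \<in> card ` {I \<in> indeps M. I \<subseteq> X}" by (simp only: rk_def)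
  then obtain I where "rk M X = card I" "I \<in> {I \<in> indeps M. I \<subseteq> X}"
    by (rule imageE)
  then show ?thesis by (intro bexI[of _ I]) simp_all
qed

lemma rk_ground:
  assumes B: "B \<in> bases M"
  shows "rk M (ground M) = card B"
proof (rule order_antisym)
  obtain I where "I \<in> indeps M" "card I = rk M (ground M)"
    using rk_attained[of M "ground M"] by blast
  then show "rk M (ground M) \<le> card B" using bases_card_max[OF B] by metis
  have "B \<in> indeps M" using B by (simp add: bases_def)
  then show "card B \<le> rk M (ground M)" by (intro rk_ge indeps_subset_ground)
qed

lemma coindependent_iff_rk:
  "coindependent M D \<longleftrightarrow> D \<subseteq> ground M \<and> rk M (ground M - D) = rk M (ground M)"
proof
  assume "coindependent M D"
  then obtain B where B: "B \<in> bases M" "D \<subseteq> ground M - B"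
    by (auto simp: coindependent_def indeps_dual)
  have BI: "B \<in> indeps M" using B by (simp add: bases_def)
  obtain I where I: "I \<in> indeps M" "card I = rk M (ground M - D)"
    using rk_attained[of M "ground M - D"] by blast
  have "card B \<le> rk M (ground M - D)"
    using B indeps_subset_ground[OF BI] by (intro rk_ge[OF BI]) auto
  then show "D \<subseteq> ground M \<and> rk M (ground M - D) = rk M (ground M)"
    using B I bases_card_max[OF B(1) I(1)] rk_ground[OF B(1)] by auto
next
  assume D: "D \<subseteq> ground M \<and> rk M (ground M - D) = rk M (ground M)"
  obtain I where I: "I \<in> indeps M" "I \<subseteq> ground M - D" "card I = rk M (ground M - D)"
    using rk_attained[of M "ground M - D"] by blast
  obtain B where B: "B \<in> bases M" using bases_nonempty by blast
  have "I \<in> bases M" using basesI[OF B I(1)] I D rk_ground[OF B] by simp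
  then show "coindependent M D" using D I by (auto simp: coindependent_def indeps_dual)
qed


section \<open>Adjoints\<close>

lemma simple_pair_indeps:
  assumes M: "simple_matroid M" and ef: "e \<in> ground M" "f \<in> ground M"
  shows "{e, f} \<in> indeps M"
proof -
  have single: "{x} \<in> indeps M" if "x \<in> ground M" for x
    using M that empty_indeps[of M] unfolding simple_matroid_def circuits_def
    by (auto simp: psubset_eq subset_singleton_iff)
  have "X \<in> indeps M" if "X \<subset> {e, f}" for X
  proof -
    have "X \<subseteq> {e} \<or> X \<subseteq> {f}" using that by blast
    then show ?thesis using single ef indeps_subset by metis
  qed
  then show ?thesis using M ef unfolding simple_matroid_def circuits_def by blast
qed

lemma points_simple:
  assumes M: "simple_matroid M"
  shows "points M = (\<lambda>e. {e}) ` ground M"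
proof (intro equalityI subsetI)
  have rk2: "2 \<le> rk M X" if "e \<in> ground M" "f \<in> ground M" "e \<noteq> f" "{e, f} \<subseteq> X" for e f X
    using rk_ge[OF simple_pair_indeps[OF M that(1,2)] that(4)] that(3) by simp
  {
    fix P assume P: "P \<in> points M"
    obtain I where I: "I \<subseteq> P" "card I = 1"
      using rk_attained[of M P] P by (auto simp: points_def)
    then obtain e where e: "e \<in> P" by (auto simp: card_1_singleton_iff)
    have "f = e" if "f \<in> P" for f
      using rk2[of e f P] P e that by (auto simp: points_def flats_def)
    then show "P \<in> (\<lambda>e. {e}) ` ground M" using e P by (auto simp: points_def flats_def)
  next
    fix P assume "P \<in> (\<lambda>e. {e}) ` ground M"
    then obtain e where e: "e \<in> ground M" "P = {e}" by blast
    obtain I where I: "I \<subseteq> {e}" "card I = rk M {e}"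
      using rk_attained[of M "{e}"] by blast
    have "rk M {e} = 1"
      using rk_ge[OF simple_pair_indeps[OF M e(1) e(1)], of "{e}"] card_mono[OF _ I(1)] I(2) by simp
    moreover have "rk M {f, e} \<noteq> 1" if "f \<in> ground M" "f \<noteq> e" for f
      using rk2[OF that(1) e(1) that(2) subset_refl] by simp
    ultimately show "P \<in> points M"
      using e by (auto simp: points_def flats_def cl_def)
  }
qed

definition adjoint_map :: "'a matroid \<Rightarrow> 'b matroid \<Rightarrow> ('a set \<Rightarrow> 'b set) \<Rightarrow> bool" where
  "adjoint_map M M' \<phi> \<longleftrightarrow>
     simple_matroid M' \<and> rk M' (ground M') = rk M (ground M) \<and>
     \<phi> ` flats M \<subseteq> flats M' \<and>
     inj_on \<phi> (flats M) \<and>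
     (\<forall>F1\<in>flats M. \<forall>F2\<in>flats M. F1 \<subseteq> F2 \<longrightarrow> \<phi> F2 \<subseteq> \<phi> F1) \<and>
     bij_betw \<phi> (hyperplanes M) (points M')"

definition hyperplanes_drop :: "'a matroid \<Rightarrow> 'a set \<Rightarrow> 'a set set" where
  "hyperplanes_drop M D = {H \<in> hyperplanes M. rk M (H - D) < rk M H}"

text \<open>An adjoint map sends a hyperplane to a point, that is, to a singleton \<open>{e}\<close>, which is
  identified with the element \<open>e\<close> (see \<open>points_simple\<close>). This is the image of a set of hyperplanes, read as a set of
  elements.\<close>
definition image_elements :: "'b matroid \<Rightarrow> ('a set \<Rightarrow> 'b set) \<Rightarrow> 'a set set \<Rightarrow> 'b set" where
  "image_elements M' \<phi> \<H> = {e \<in> ground M'. {e} \<in> \<phi> ` \<H>}"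

end

theory Submission
  imports Defs
begin

text \<open>Comparing maximal chains shows that an injective order-reversing map \<open>\<phi>\<close> between the flats of
  matroids of equal rank \<open>r\<close> sends rank \<open>k\<close> to rank \<open>r - k\<close>. The crucial point is that an adjoint
  map also reflects the order against hyperplanes: \<open>\<phi> H \<subseteq> \<phi> F\<close> only if \<open>F \<subseteq> H\<close>. Suppose that
  \<open>e \<in> F - H\<close>. Then \<open>\<phi> H \<subseteq> \<phi> (cl {e})\<close>, and adding elements of \<open>H\<close> one by one preserves
  \<open>\<phi> H \<subseteq> \<phi> (cl (I \<union> {e}))\<close>, because \<open>\<phi> F\<^sub>1 \<inter> \<phi> F\<^sub>2\<close> is the image of the join of
  \<open>F\<^sub>1\<close> and \<open>F\<^sub>2\<close> whenever these are distinct flats covering a common flat. This continues until \<open>I\<close> spans \<open>H\<close> and \<open>\<phi> H\<close> is contained in the image of the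
  ground set, which is empty. Injectivity of the new map follows because two different
  flats of \<open>M \ D\<close> are separated by a hyperplane spanned outside \<open>D\<close>, whose image is a point that
  is not deleted. The rank of \<open>N\<close> is then forced by the chain argument for the new map.\<close>

section \<open>Rank, closure and flats\<close>

lemma rk_mono: "A \<subseteq> B \<Longrightarrow> rk M A \<le> rk M B"
  using rk_attained[of M A] rk_ge[of _ M B] by fastforce

lemma rk_insert_le: "rk M (insert x A) \<le> Suc (rk M A)"
proof -
  obtain I where I: "I \<in> indeps M" "I \<subseteq> insert x A" "card I = rk M (insert x A)"
    using rk_attained[of M "insert x A"] by blast
  have "I - {x} \<in> indeps M" using I indeps_subset by blast
  then have "card (I - {x}) \<le> rk M A" using I by (intro rk_ge) auto
  moreover have "card I \<le> Suc (card (I - {x}))"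
    by (cases "x \<in> I") (simp_all add: card_Diff_singleton)
  ultimately show ?thesis using I by simp
qed

text \<open>Local form of submodularity. Extend a maximum independent subset \<open>I\<close> of
  \<open>A\<close> to a maximum one \<open>Z\<close> of \<open>B\<close>. If \<open>x\<close> raised
  the rank of \<open>B\<close>, some \<open>y\<close> would augment \<open>Z\<close>; this can only
  be \<open>x\<close>, and then \<open>insert x I\<close> contradicts \<open>eq\<close>.\<close>

lemma rk_insert_mono:
  assumes eq: "rk M (insert x A) = rk M A" and sub: "A \<subseteq> B"
  shows "rk M (insert x B) = rk M B"
proof (rule ccontr)
  assume neq: "\<not> ?thesis"
  obtain I where I: "I \<in> indeps M" "I \<subseteq> A" "card I = rk M A"
    using rk_attained[of M A] by blast
  obtain J where J: "J \<in> indeps M" "J \<subseteq> B" "card J = rk M B"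
    using rk_attained[of M B] by blast
  have "card I \<le> card J" using I J rk_mono[OF sub] by simp
  then obtain Z where Z: "Z \<in> indeps M" "I \<subseteq> Z" "Z \<subseteq> I \<union> J" "card Z = card J"
    using indeps_extend[OF I(1) J(1)] by blast
  obtain K where K: "K \<in> indeps M" "K \<subseteq> insert x B" "card K = rk M (insert x B)"
    using rk_attained[of M "insert x B"] by blast
  have "card Z < card K" using neq rk_mono[OF subset_insertI, of M B x] Z J K by simp
  then obtain y where y: "y \<in> K - Z" "insert y Z \<in> indeps M"
    using indeps_augment[OF Z(1) K(1)] by blast
  have cy: "card (insert y Z) = Suc (rk M B)"
    using y Z J indeps_finite[OF Z(1)] by simp
  have "y = x"
  proof (rule ccontr)
    assume "y \<noteq> x"
    then have "insert y Z \<subseteq> B" using y(1) K(2) Z(3) I(2) J(2) sub by blast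
    from rk_ge[OF y(2) this] cy show False by simp
  qed
  moreover have "insert y I \<in> indeps M" using indeps_subset[OF y(2)] Z by blast
  ultimately have "card (insert y I) \<le> rk M (insert x A)" using I by (intro rk_ge) auto
  moreover have "card (insert y I) = Suc (card I)"
    using y(1) Z(2) indeps_finite[OF I(1)] by (intro card_insert_disjoint) auto
  ultimately show False using eq I by simp
qed

lemma rk_Un_cl:
  assumes "Y \<subseteq> cl M X"
  shows "rk M (X \<union> Y) = rk M X"
proof -
  have "finite Y" using assms finite_ground[of M] by (auto simp: cl_def intro: finite_subset)
  then show ?thesis using assms
  proof (induction Y)
    case (insert y Y)
    then have "rk M (insert y X) = rk M X" by (simp add: cl_def)
    then have "rk M (insert y (X \<union> Y)) = rk M (X \<union> Y)" by (rule rk_insert_mono) auto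
    then show ?case using insert by simp
  qed simp
qed

lemma cl_subset_ground: "cl M X \<subseteq> ground M"
  by (auto simp: cl_def)

lemma subset_cl: "X \<subseteq> ground M \<Longrightarrow> X \<subseteq> cl M X"
  by (auto simp: cl_def insert_absorb)

lemma rk_cl: "X \<subseteq> ground M \<Longrightarrow> rk M (cl M X) = rk M X"
  using rk_Un_cl[of "cl M X" M X] subset_cl[of X M] by (simp add: Un_absorb1)

lemma cl_mono: "X \<subseteq> Y \<Longrightarrow> cl M X \<subseteq> cl M Y"
  using rk_insert_mono[of M _ X Y] by (auto simp: cl_def)

lemma cl_flat:
  assumes X: "X \<subseteq> ground M"
  shows "cl M X \<in> flats M"
proof -
  have "e \<in> cl M X" if e: "e \<in> cl M (cl M X)" for e
  proof -
    have "rk M (insert e X) \<le> rk M (insert e (cl M X))"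
      using subset_cl[OF X] by (intro rk_mono) auto
    also have "\<dots> = rk M X" using e rk_cl[OF X] by (simp add: cl_def)
    finally show ?thesis using e rk_mono[OF subset_insertI, of M X e] by (auto simp: cl_def)
  qed
  then show ?thesis
    using subset_cl[OF cl_subset_ground[of M X]] cl_subset_ground[of M X] by (auto simp: flats_def)
qed

lemma flat_subset_ground: "F \<in> flats M \<Longrightarrow> F \<subseteq> ground M"
  by (simp add: flats_def)

lemma cl_of_flat: "F \<in> flats M \<Longrightarrow> cl M F = F"
  by (simp add: flats_def)

lemma cl_subset_flat: "X \<subseteq> F \<Longrightarrow> F \<in> flats M \<Longrightarrow> cl M X \<subseteq> F"
  using cl_mono[of X F M] by (simp add: flats_def)

lemma flat_Int:
  assumes "F \<in> flats M" "G \<in> flats M"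
  shows "F \<inter> G \<in> flats M"
proof -
  have "cl M (F \<inter> G) \<subseteq> F \<inter> G" using cl_subset_flat[of "F \<inter> G" _ M] assms by (simp add: le_infI1 le_infI2)
  moreover have "F \<inter> G \<subseteq> ground M" using flat_subset_ground assms by blast
  ultimately show ?thesis using subset_cl by (auto simp: flats_def)
qed

lemma rk_insert_notin:
  assumes "x \<in> ground M" "x \<notin> cl M X"
  shows "rk M (insert x X) = Suc (rk M X)"
  using assms rk_insert_le[of M x X] rk_mono[OF subset_insertI, of M X x] by (auto simp: cl_def)

lemma rk_flat_strict:
  assumes F: "F \<in> flats M" and G: "G \<in> flats M" and "F \<subset> G"
  shows "rk M F < rk M G"
proof -
  obtain x where x: "x \<in> G" "x \<notin> F" using assms by blast
  then have "rk M (insert x F) = Suc (rk M F)"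
    using flat_subset_ground[OF G] cl_of_flat[OF F] by (intro rk_insert_notin) auto
  then show ?thesis using rk_mono[of "insert x F" G M] x assms by auto
qed

lemma flat_eqI:
  assumes "F \<in> flats M" "G \<in> flats M" "F \<subseteq> G" "rk M G \<le> rk M F"
  shows "F = G"
  using rk_flat_strict[OF assms(1,2)] assms(3,4) by auto

text \<open>Among the flats that contain \<open>F\<close> and avoid \<open>e\<close>, a maximal one
  is a hyperplane, because together with \<open>e\<close> it spans the ground set.\<close>

lemma hyperplane_separating:
  assumes F: "F \<in> flats M" and e: "e \<in> ground M" "e \<notin> F"
  obtains H where "H \<in> hyperplanes M" "F \<subseteq> H" "e \<notin> H"
proof -
  let ?S = "{G \<in> flats M. F \<subseteq> G \<and> e \<notin> G}"
  have "?S \<subseteq> Pow (ground M)" by (auto simp: flats_def)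
  then have "finite ?S" using finite_ground[of M] by (meson finite_Pow_iff finite_subset)
  moreover have "?S \<noteq> {}" using F e by blast
  ultimately obtain H where H: "H \<in> ?S" and max: "\<forall>G\<in>?S. H \<subseteq> G \<longrightarrow> H = G"
    using finite_has_maximal[of ?S] by blast
  have Hg: "H \<subseteq> ground M" and Hf: "H \<in> flats M" using H by (auto simp: flats_def)
  have "x \<in> cl M (insert e H)" if x: "x \<in> ground M" for x
  proof (rule ccontr)
    assume n: "x \<notin> cl M (insert e H)"
    have xH: "insert x H \<subseteq> ground M" using x Hg by blast
    have sub: "insert x H \<subseteq> cl M (insert x H)" using subset_cl[OF xH] .
    have "x \<notin> H" using n subset_cl[of "insert e H" M] e Hg by blast
    then have "cl M (insert x H) \<noteq> H" using sub by blast
    \<comment> \<open>By maximality the larger flat cannot avoid \<open>e\<close>. Hence adding both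
      \<open>x\<close> and \<open>e\<close> raises the rank of \<open>H\<close> by at most one,
      which \<open>e\<close> alone already does, so \<open>x\<close> lies in
      \<open>cl M (insert e H)\<close> after all.\<close>
    then have "e \<in> cl M (insert x H)"
      using max cl_flat[OF xH] sub H by blast
    then have "rk M (insert e (insert x H)) = rk M (insert x H)" by (simp add: cl_def)
    also have "\<dots> \<le> Suc (rk M H)" by (rule rk_insert_le)
    also have "\<dots> = rk M (insert e H)"
      using H e cl_of_flat[OF Hf] by (intro rk_insert_notin[symmetric]) auto
    finally have "rk M (insert e (insert x H)) \<le> rk M (insert e H)" .
    then show False using rk_insert_notin[OF x n] by (simp add: insert_commute)
  qed
  then have "cl M (insert e H) = ground M" using cl_subset_ground[of M "insert e H"] by blast
  then have "rk M (ground M) = rk M (insert e H)" using rk_cl[of "insert e H" M] e Hg by simp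
  also have "\<dots> = Suc (rk M H)"
    using H e cl_of_flat[OF Hf] by (intro rk_insert_notin) auto
  finally have "H \<in> hyperplanes M" using Hf by (simp add: hyperplanes_def)
  then show ?thesis using that H by blast
qed

section \<open>Flats of a deletion\<close>

lemma rk_deletion: "rk (deletion M D) X = rk M (X - D)"
proof -
  have "{I \<in> indeps (deletion M D). I \<subseteq> X} = {I \<in> indeps M. I \<subseteq> X - D}"
    by (auto simp: indeps_deletion)
  then show ?thesis by (simp add: rk_def)
qed

lemma cl_deletion: "X \<inter> D = {} \<Longrightarrow> cl (deletion M D) X = cl M X - D"
  by (auto simp: cl_def ground_deletion rk_deletion Diff_triv insert_Diff_if)

lemma flat_Diff_deletion:
  assumes "F \<in> flats M"
  shows "F - D \<in> flats (deletion M D)"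
proof -
  have "cl M (F - D) \<subseteq> F" using assms by (intro cl_subset_flat) auto
  moreover have "F - D \<subseteq> cl M (F - D)" using flat_subset_ground[OF assms] by (intro subset_cl) auto
  ultimately show ?thesis using flat_subset_ground[OF assms] cl_deletion[of "F - D" D M]
    by (auto simp: flats_def ground_deletion)
qed

text \<open>Closure in \<open>M\<close> embeds the flats of the deletion into those of
  \<open>M\<close>, and removing \<open>D\<close> undoes it.\<close>

lemma flat_deletionD:
  assumes "F \<in> flats (deletion M D)"
  shows "F \<subseteq> ground M" "F \<inter> D = {}" "cl M F - D = F" "cl M F \<in> flats M"
proof -
  show F: "F \<subseteq> ground M" "F \<inter> D = {}"
    using flat_subset_ground[OF assms] by (auto simp: ground_deletion)
  show "cl M F - D = F" using cl_of_flat[OF assms] cl_deletion[OF F(2)] by simp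
  show "cl M F \<in> flats M" using cl_flat[OF F(1)] .
qed

lemma simple_deletion: "simple_matroid M \<Longrightarrow> simple_matroid (deletion M D)"
proof -
  have "C \<in> circuits M" if "C \<in> circuits (deletion M D)" for C
    using that unfolding circuits_def ground_deletion indeps_deletion by blast
  then show "simple_matroid M \<Longrightarrow> simple_matroid (deletion M D)"
    unfolding simple_matroid_def by blast
qed

text \<open>By coindependence the deletion has the rank of \<open>M\<close>, so \<open>H\<close> has
  corank one in \<open>M\<close> as well. Removing \<open>D\<close> from its closure leaves
  \<open>H\<close>, of the same rank, so the closure is not dropped.\<close>

lemma cl_hyperplane_deletion:
  assumes D: "coindependent M D" and H: "H \<in> hyperplanes (deletion M D)"
  shows "cl M H \<in> hyperplanes M - hyperplanes_drop M D"
proof -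
  have F: "H \<in> flats (deletion M D)" using H by (simp add: hyperplanes_def)
  note HF = flat_deletionD[OF F]
  have "rk M H + 1 = rk M (ground M)"
    using H D HF(2) by (simp add: hyperplanes_def rk_deletion ground_deletion coindependent_iff_rk Diff_triv)
  then show ?thesis
    using HF by (simp add: hyperplanes_def hyperplanes_drop_def rk_cl)
qed

text \<open>With the previous lemma, closure in \<open>M\<close> and removal of \<open>D\<close> are
  mutually inverse between the hyperplanes of the deletion and those of \<open>M\<close> that are
  not dropped.\<close>

lemma hyperplane_Diff:
  assumes D: "coindependent M D" and H: "H \<in> hyperplanes M" "H \<notin> hyperplanes_drop M D"
  shows "H - D \<in> hyperplanes (deletion M D)" "cl M (H - D) = H"
proof -
  have HF: "H \<in> flats M" using H by (simp add: hyperplanes_def)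
  have rk: "rk M (H - D) = rk M H"
    using H rk_mono[of "H - D" H M] by (auto simp: hyperplanes_drop_def)
  then show "H - D \<in> hyperplanes (deletion M D)"
    using flat_Diff_deletion[OF HF] H D
    by (simp add: hyperplanes_def rk_deletion ground_deletion coindependent_iff_rk)
  have sub: "H - D \<subseteq> ground M" using flat_subset_ground[OF HF] by blast
  show "cl M (H - D) = H"
    using HF cl_flat[OF sub] cl_subset_flat[of "H - D" H M] rk rk_cl[OF sub]
    by (intro flat_eqI) auto
qed

section \<open>Order-reversing injections between lattices of flats\<close>

text \<open>Add the elements of \<open>J\<close> to \<open>I\<close> one at a time. Each rise of the
  rank in \<open>M\<close> is by one and enlarges the closure, so injectivity forces the rank of the
  image to fall by at least one.\<close>

lemma rk_antitone_chain:
  assumes flat: "\<phi> ` flats M \<subseteq> flats N"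
    and inj: "inj_on \<phi> (flats M)"
    and anti: "\<And>F G. F \<in> flats M \<Longrightarrow> G \<in> flats M \<Longrightarrow> F \<subseteq> G \<Longrightarrow> \<phi> G \<subseteq> \<phi> F"
    and I: "I \<subseteq> ground M" and J: "J \<subseteq> ground M"
  shows "rk N (\<phi> (cl M (I \<union> J))) + rk M (I \<union> J) \<le> rk N (\<phi> (cl M I)) + rk M I"
proof -
  have "finite J" using J finite_ground finite_subset by blast
  then show ?thesis using J
  proof (induction J)
    case (insert x J)
    let ?A = "I \<union> J"
    have A: "?A \<subseteq> ground M" "insert x ?A \<subseteq> ground M" using I insert.prems by auto
    note fl = cl_flat[OF A(1)] cl_flat[OF A(2)]
    have sub: "cl M ?A \<subseteq> cl M (insert x ?A)" by (rule cl_mono) auto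
    have "rk N (\<phi> (cl M (insert x ?A))) + rk M (insert x ?A) \<le> rk N (\<phi> (cl M ?A)) + rk M ?A"
    proof (cases "x \<in> cl M ?A")
      case True
      then have eq: "rk M (insert x ?A) = rk M ?A" by (simp add: cl_def)
      then have "cl M ?A = cl M (insert x ?A)"
        using flat_eqI[OF fl sub] rk_cl[OF A(1)] rk_cl[OF A(2)] by simp
      then show ?thesis using eq by simp
    next
      case False
      have "x \<in> cl M (insert x ?A)" using subset_cl[OF A(2)] by blast
      then have "\<phi> (cl M ?A) \<noteq> \<phi> (cl M (insert x ?A))"
        using inj_onD[OF inj _ fl] False by blast
      then have "\<phi> (cl M (insert x ?A)) \<subset> \<phi> (cl M ?A)" using anti[OF fl sub] by blast
      then have "rk N (\<phi> (cl M (insert x ?A))) < rk N (\<phi> (cl M ?A))"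
        using flat fl by (intro rk_flat_strict) auto
      then show ?thesis using rk_insert_le[of M x ?A] by simp
    qed
    then show ?case using insert by simp
  qed simp
qed

section \<open>Adjoint maps: complementary ranks and order reflection\<close>

lemma adjoint_mapD:
  assumes "adjoint_map M N \<phi>"
  shows "simple_matroid N" "rk N (ground N) = rk M (ground M)" "\<phi> ` flats M \<subseteq> flats N"
    "inj_on \<phi> (flats M)"
    "F \<in> flats M \<Longrightarrow> G \<in> flats M \<Longrightarrow> F \<subseteq> G \<Longrightarrow> \<phi> G \<subseteq> \<phi> F"
    "bij_betw \<phi> (hyperplanes M) (points N)"
  using assms by (auto simp: adjoint_map_def)

text \<open>The chain from the empty set up to \<open>F\<close> gives one inequality, the chain from
  \<open>F\<close> up to the ground set the other; the equal ranks of \<open>M\<close> and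
  \<open>N\<close> make the bounds agree.\<close>

lemma rk_adjoint:
  assumes ad: "adjoint_map M N \<phi>" and F: "F \<in> flats M"
  shows "rk N (\<phi> F) + rk M F = rk M (ground M)"
proof (rule order_antisym)
  note adj = adjoint_mapD[OF ad]
  note FG = flat_subset_ground[OF F]
  have "\<phi> (cl M {}) \<subseteq> ground N" using adj(3) cl_flat[of "{}" M] flat_subset_ground by blast
  then have "rk N (\<phi> (cl M {})) \<le> rk M (ground M)"
    using rk_mono[of _ "ground N" N] adj(2) by metis
  moreover have "rk M {} = 0" using rk_attained[of M "{}"] by auto
  ultimately show "rk N (\<phi> F) + rk M F \<le> rk M (ground M)"
    using rk_antitone_chain[OF adj(3-5) _ FG, of "{}"] cl_of_flat[OF F] by simp
  show "rk M (ground M) \<le> rk N (\<phi> F) + rk M F"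
    using rk_antitone_chain[OF adj(3-5) FG subset_refl] cl_of_flat[OF F] FG
    by (simp add: Un_absorb1)
qed

lemma adjoint_hyperplane_reflect:
  assumes ad: "adjoint_map M N \<phi>" and H: "H \<in> hyperplanes M" and F: "F \<in> flats M"
    and sub: "\<phi> H \<subseteq> \<phi> F"
  shows "F \<subseteq> H"
proof
  fix e assume eF: "e \<in> F"
  note adj = adjoint_mapD[OF ad]
  have HF: "H \<in> flats M" using H by (simp add: hyperplanes_def)
  have HG: "H \<subseteq> ground M" using flat_subset_ground[OF HF] .
  have eG: "e \<in> ground M" using eF flat_subset_ground[OF F] by blast
  show "e \<in> H"
  proof (rule ccontr)
    assume eH: "e \<notin> H"
    have "\<phi> H \<subseteq> \<phi> (cl M (insert e I))" if "I \<subseteq> H" for I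
    proof -
      have "finite I" using that HG finite_ground finite_subset by metis
      then show ?thesis using that
      proof (induction I)
        case empty
        have "cl M {e} \<subseteq> F" using eF F by (intro cl_subset_flat) auto
        then show ?case using sub adj(5)[OF cl_flat F] eG by blast
      next
        case (insert f I)
        have I: "I \<subseteq> ground M" and f: "f \<in> ground M" using insert.prems HG by auto
        let ?F = "cl M (insert e I)" and ?G = "cl M (insert f I)"
          and ?K = "cl M (insert e (insert f I))"
        have g: "insert e I \<subseteq> ground M" "insert f I \<subseteq> ground M"
            "insert e (insert f I) \<subseteq> ground M"
          using I f eG by auto
        note fl = g[THEN cl_flat]
        have KF: "?F \<subseteq> ?K" "?G \<subseteq> ?K" by (rule cl_mono; auto)+
        have IH: "\<phi> H \<subseteq> \<phi> ?F" using insert by blast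
        show ?case
        proof (cases "f \<in> cl M I")
          case True
          then have "f \<in> ?F" using cl_mono[of I "insert e I" M] by blast
          then have "?K \<subseteq> ?F" using subset_cl[OF g(1)] fl(1) by (intro cl_subset_flat) auto
          then show ?thesis using IH KF by simp
        next
          case False
          have GH: "?G \<subseteq> H" using insert.prems HF by (intro cl_subset_flat) auto
          then have eGcl: "e \<notin> ?G" using eH by blast
          then have "e \<notin> cl M I" using cl_mono[of I "insert f I" M] by blast
          \<comment> \<open>\<open>?F\<close> and \<open>?G\<close> both cover
            \<open>cl M I\<close>, and their join \<open>?K\<close> has rank one higher
            still.\<close>
          then have rk: "rk M ?F = Suc (rk M I)" "rk M ?G = Suc (rk M I)"
              "rk M ?K = Suc (Suc (rk M I))"
            using g rk_insert_notin[OF eG eGcl] rk_insert_notin[OF eG] rk_insert_notin[OF f False]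
            by (simp_all add: rk_cl)
          note fl' = fl[THEN imageI, THEN subsetD[OF adj(3)]]
          have "e \<in> ?F" using subset_cl[OF g(1)] by blast
          then have neq: "\<phi> ?F \<noteq> \<phi> ?G" using inj_onD[OF adj(4) _ fl(1,2)] eGcl by blast
          have eqrk: "rk N (\<phi> ?F) = rk N (\<phi> ?G)" "Suc (rk N (\<phi> ?K)) = rk N (\<phi> ?F)"
            using fl[THEN rk_adjoint[OF ad]] rk by simp_all
          \<comment> \<open>Distinct flats of equal rank meet in a flat of smaller rank. Here that
            rank is at most the rank of \<open>\<phi> ?K\<close>, which lies in the intersection, so
            the two flats coincide.\<close>
          have "\<not> \<phi> ?F \<subseteq> \<phi> ?G" using flat_eqI[OF fl'(1,2)] neq eqrk by auto
          then have "\<phi> ?F \<inter> \<phi> ?G \<subset> \<phi> ?F" by blast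
          then have "rk N (\<phi> ?F \<inter> \<phi> ?G) < rk N (\<phi> ?F)"
            using fl' flat_Int by (intro rk_flat_strict)
          moreover have "\<phi> ?K \<subseteq> \<phi> ?F \<inter> \<phi> ?G"
            using adj(5)[OF fl(1,3) KF(1)] adj(5)[OF fl(2,3) KF(2)] by blast
          ultimately have "\<phi> ?K = \<phi> ?F \<inter> \<phi> ?G"
            using fl' flat_Int eqrk by (intro flat_eqI) auto
          moreover have "\<phi> H \<subseteq> \<phi> ?G" using adj(5)[OF fl(2) HF GH] .
          ultimately show ?thesis using IH by simp
        qed
      qed
    qed
    then have *: "\<phi> H \<subseteq> \<phi> (cl M (insert e H))" by blast
    have g: "insert e H \<subseteq> ground M" using eG HG by blast
    \<comment> \<open>A hyperplane and an element outside it span, so the image of their closure has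
      rank 0, while \<open>\<phi> H\<close> has rank 1.\<close>
    have "rk M (insert e H) = rk M (ground M)"
      using rk_insert_notin[OF eG] eH H cl_of_flat[OF HF] by (simp add: hyperplanes_def)
    then have "rk N (\<phi> (cl M (insert e H))) = 0"
      using rk_adjoint[OF ad cl_flat[OF g]] rk_cl[OF g] by simp
    then have "rk N (\<phi> H) = 0" using rk_mono[OF *, of N] by simp
    then show False using rk_adjoint[OF ad HF] H by (simp add: hyperplanes_def)
  qed
qed

section \<open>The adjoint map of a deletion\<close>

theorem lemma3p3:
  fixes M :: "'a matroid" and M' :: "'b matroid" and \<phi> :: "'a set \<Rightarrow> 'b set" and D :: "'a set"
  assumes "adjoint_map M M' \<phi>"
    and "coindependent M D"
  shows "adjoint_map (deletion M D)
           (deletion M' (image_elements M' \<phi> (hyperplanes_drop M D)))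
           (\<lambda>F. \<phi> (cl M F) - image_elements M' \<phi> (hyperplanes_drop M D))"
proof -
  let ?X = "image_elements M' \<phi> (hyperplanes_drop M D)"
  let ?N = "deletion M' ?X" and ?M = "deletion M D" and ?\<psi> = "\<lambda>F. \<phi> (cl M F) - ?X"
  note adj = adjoint_mapD[OF assms(1)]
  have drop: "hyperplanes_drop M D \<subseteq> hyperplanes M" by (auto simp: hyperplanes_drop_def)
  have point: "\<exists>p. \<phi> H = {p} \<and> p \<in> ground M'" if "H \<in> hyperplanes M" for H
    using bij_betwE[OF adj(6)] that points_simple[OF adj(1)] by blast
  \<comment> \<open>By injectivity on hyperplanes, a hyperplane that is not dropped shares its point
    with no dropped one.\<close>
  have avoid: "\<phi> H \<inter> ?X = {}" if H: "H \<in> hyperplanes M" "H \<notin> hyperplanes_drop M D" for H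
  proof -
    have "\<phi> H \<noteq> \<phi> H'" if "H' \<in> hyperplanes_drop M D" for H'
      using inj_onD[OF bij_betw_imp_inj_on[OF adj(6)], of H H'] H drop that by blast
    then show ?thesis using point[OF H(1)] by (auto simp: image_elements_def)
  qed
  have simple: "simple_matroid ?N" using simple_deletion adj(1) .
  have flat: "?\<psi> ` flats ?M \<subseteq> flats ?N"
    using adj(3) by (auto intro!: flat_Diff_deletion flat_deletionD(4))
  have anti: "?\<psi> G \<subseteq> ?\<psi> F" if "F \<in> flats ?M" "G \<in> flats ?M" "F \<subseteq> G" for F G
    using adj(5)[OF that(1)[THEN flat_deletionD(4)] that(2)[THEN flat_deletionD(4)] cl_mono[OF that(3)]]
    by blast
  \<comment> \<open>Once the order is reflected, injectivity is antisymmetry of inclusion.\<close>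
  have reflect: "F \<subseteq> G" if F: "F \<in> flats ?M" and G: "G \<in> flats ?M" and sub: "?\<psi> G \<subseteq> ?\<psi> F" for F G
  proof
    fix e assume e: "e \<in> F"
    show "e \<in> G"
    proof (rule ccontr)
      assume "e \<notin> G"
      then obtain H where H: "H \<in> hyperplanes ?M" "G \<subseteq> H" "e \<notin> H"
        using hyperplane_separating[OF G] e flat_subset_ground[OF F] by blast
      have HF: "H \<in> flats ?M" using H(1) by (simp add: hyperplanes_def)
      have cH: "cl M H \<in> hyperplanes M" "cl M H \<notin> hyperplanes_drop M D"
        using cl_hyperplane_deletion[OF assms(2) H(1)] by auto
      have "\<phi> (cl M H) \<subseteq> \<phi> (cl M G)"
        using adj(5) flat_deletionD(4)[OF G] flat_deletionD(4)[OF HF] cl_mono[OF H(2)] .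
      \<comment> \<open>The point \<open>\<phi> (cl M H)\<close> survives the deletion, so it lies
        in \<open>?\<psi> G\<close> and hence in \<open>?\<psi> F\<close>.\<close>
      then have "\<phi> (cl M H) \<subseteq> \<phi> (cl M F)" using avoid[OF cH] sub by blast
      then have "cl M F \<subseteq> cl M H"
        using adjoint_hyperplane_reflect[OF assms(1) cH(1) flat_deletionD(4)[OF F]] by blast
      then show False using flat_deletionD(3)[OF F] flat_deletionD(3)[OF HF] e H(3) by blast
    qed
  qed
  have inj: "inj_on ?\<psi> (flats ?M)"
    using reflect by (intro inj_onI subset_antisym) auto
  have rkM: "rk ?M (ground ?M) = rk M (ground M)"
    using assms(2) by (simp add: rk_deletion ground_deletion coindependent_iff_rk)
  have rank: "rk ?N (ground ?N) = rk ?M (ground ?M)"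
  proof (rule order_antisym)
    show "rk ?N (ground ?N) \<le> rk ?M (ground ?M)"
      using rk_mono[of "ground M' - ?X" "ground M'" M'] adj(2) rkM
      by (simp add: rk_deletion ground_deletion)
    \<comment> \<open>For the lower bound the chain argument is applied to \<open>?\<psi>\<close>
      itself: from the closure of the empty set to the ground set, the rank of the image falls by at
      least the rank of \<open>?M\<close>.\<close>
    have "?\<psi> (cl ?M {}) \<subseteq> ground ?N"
      using flat cl_flat[of "{}" ?M] flat_subset_ground by blast
    then have "rk ?N (?\<psi> (cl ?M {})) \<le> rk ?N (ground ?N)" by (rule rk_mono)
    moreover have "rk ?M {} = 0" using rk_attained[of ?M "{}"] by auto
    ultimately show "rk ?M (ground ?M) \<le> rk ?N (ground ?N)"
      using rk_antitone_chain[OF flat inj anti, of "{}" "ground ?M"] by simp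
  qed
  have "?\<psi> ` hyperplanes ?M = points ?N"
  proof (intro equalityI subsetI)
    fix P assume "P \<in> ?\<psi> ` hyperplanes ?M"
    then obtain H where H: "H \<in> hyperplanes ?M" "P = ?\<psi> H" by blast
    have cH: "cl M H \<in> hyperplanes M" "cl M H \<notin> hyperplanes_drop M D"
      using cl_hyperplane_deletion[OF assms(2) H(1)] by auto
    then show "P \<in> points ?N"
      using point[OF cH(1)] avoid[OF cH] H(2) points_simple[OF simple]
      by (auto simp: ground_deletion)
  next
    fix P assume "P \<in> points ?N"
    then obtain p where p: "P = {p}" "p \<in> ground M'" "p \<notin> ?X"
      using points_simple[OF simple] by (auto simp: ground_deletion)
    then have "{p} \<in> points M'" using points_simple[OF adj(1)] by blast
    then obtain H where H: "H \<in> hyperplanes M" "\<phi> H = {p}"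
      using bij_betw_imp_surj_on[OF adj(6)] by (metis imageE)
    \<comment> \<open>Were \<open>H\<close> dropped, \<open>p\<close> would have been deleted. So
      \<open>H - D\<close> has closure \<open>H\<close> and is the required preimage of
      \<open>P\<close>.\<close>
    have "H \<notin> hyperplanes_drop M D"
      using p H by (auto simp: image_elements_def image_iff)
    note HD = hyperplane_Diff[OF assms(2) H(1) this]
    have "P = ?\<psi> (H - D)" using HD(2) H(2) p by auto
    then show "P \<in> ?\<psi> ` hyperplanes ?M" using HD(1) by blast
  qed
  moreover have "inj_on ?\<psi> (hyperplanes ?M)"
    by (rule inj_on_subset[OF inj]) (auto simp: hyperplanes_def)
  ultimately have "bij_betw ?\<psi> (hyperplanes ?M) (points ?N)" by (simp add: bij_betw_def)
  then show ?thesis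
    unfolding adjoint_map_def using simple rank flat inj anti by blast
qed

end
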